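(* Let $(X,d)$ be a metric space and let $K\subset X$ be a homogeneous compact set with a scale function $h:(0,\varepsilon)\to\mathbb{R}^+$. Then $$\dim_A K=\lim_{\rho\to0}\left(\sup_{R}\left|\frac{h(R)\log R-h(\rho R)\log(\rho R)}{\log\rho}\right|\right),$$ where $\rho\in(0,1)$ and the supremum is over $R\in(0,\varepsilon)$.
   Context: Assouad dimension: for a metric space $Y$ and $0<r<R$, $N_{r,R}(Y)$ is the smallest number $N$ such that every ball of radius $R$ in $Y$ can be covered by $N$ balls of radius $r$. Then $$\dim_A(Y)=\inf\{\alpha\ge 0:\ \exists\, b,c>0 \text{ such that } N_{r,R}(Y)\le c(R/r)^\alpha \text{ for all } 0<r<R<b\}.$$ A subset of $X$ is regarded as a metric space with the restricted metric. $|K|$ denotes the diameter of $K$, and $B(x,r)$ the closed ball with center $x$ and radius $r$. Homogeneous sets: a compact subset $K$ of $X$ is homogeneous if there exist a Borel measure $\mu$ supported on $K$ and constants $0<\eta<1\le\lambda$ and $1<\delta\le\Delta<\infty$ such that for all $x,x'\in K$ and all $0<r\le|K|$, $$\lambda^{-1}\le\frac{\mu(B(x,r))}{\mu(B(x',r))}\le\lambda\qquad\text{and}\qquad \delta\le\frac{\mu(B(x,r))}{\mu(B(x,\eta r))}\le\Delta .$$ (In particular these ball measures are positive and finite.) Scale functions: for $x\in K$ put $\alpha_x(r)=\dfrac{\log\mu(B(x,r))}{\log r}$ for $0<r\le|K|$. Let $$\Omega=\{g:(0,\varepsilon)\to\mathbb{R}^+\ |\ 0<\inf_{r<\varepsilon}g(r)\le\sup_{r<\varepsilon}g(r)<\infty\},$$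 where $0<\varepsilon<1$, $\varepsilon\le|K|$, is small enough that $\alpha_x$ restricted to $(0,\varepsilon)$ belongs to $\Omega$ for all $x\in K$. Two functions $g,h\in\Omega$ are equivalent, $g\sim h$, if there is a constant $C$ with $|h(r)-g(r)|\le C|\log r|^{-1}$ for all $r<\varepsilon$. The functions $\alpha_x$, $x\in K$, are all equivalent. A scale function of $K$ is any function $h\in\Omega$ equivalent to $\alpha_x$ for $x\in K$. *)

theory Defs
  imports "HOL-Analysis.Analysis"
begin

text \<open>
  A subset \<open>Y\<close> of the ambient space is regarded as a metric space with the restricted metric:
  its balls are the sets \<open>cball x r \<inter> Y\<close> with centre \<open>x \<in> Y\<close>. The value is \<open>\<infinity>\<close> if no finite
  number of balls suffices.
\<close>

definition cover_number :: "'a::metric_space set \<Rightarrow> real \<Rightarrow> real \<Rightarrow> enat" where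
  "cover_number Y r R =
     Inf {enat N | N. \<forall>x\<in>Y. \<exists>C\<subseteq>Y. finite C \<and> card C \<le> N \<and>
                        cball x R \<inter> Y \<subseteq> (\<Union>c\<in>C. cball c r \<inter> Y)}"

definition assouad_dim :: "'a::metric_space set \<Rightarrow> ereal" where
  "assouad_dim Y =
     Inf {ereal \<alpha> | \<alpha>. 0 \<le> \<alpha> \<and>
       (\<exists>b>0. \<exists>c>0. \<forall>r R. 0 < r \<and> r < R \<and> R < b \<longrightarrow>
          ereal_of_enat (cover_number Y r R) \<le> ereal (c * (R / r) powr \<alpha>))}"

text \<open>
  Positivity and finiteness of the ball measures are explicit, so that the real-valued
  \<open>measure\<close> and real division carry their intended meaning.
\<close>

definition homogeneous_measure :: "'a::metric_space set \<Rightarrow> 'a measure \<Rightarrow> bool" where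
  "homogeneous_measure K \<mu> \<longleftrightarrow>
     sets \<mu> = sets borel \<and> emeasure \<mu> (- K) = 0 \<and>
     (\<forall>x\<in>K. \<forall>r. 0 < r \<and> r \<le> diameter K \<longrightarrow>
        0 < emeasure \<mu> (cball x r) \<and> emeasure \<mu> (cball x r) < \<infinity>) \<and>
     (\<exists>\<eta> L \<delta> \<Delta> :: real. 0 < \<eta> \<and> \<eta> < 1 \<and> 1 \<le> L \<and> 1 < \<delta> \<and> \<delta> \<le> \<Delta> \<and>
       (\<forall>x\<in>K. \<forall>x'\<in>K. \<forall>r. 0 < r \<and> r \<le> diameter K \<longrightarrow>
          inverse L \<le> measure \<mu> (cball x r) / measure \<mu> (cball x' r) \<and>
          measure \<mu> (cball x r) / measure \<mu> (cball x' r) \<le> L \<and>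
          \<delta> \<le> measure \<mu> (cball x r) / measure \<mu> (cball x (\<eta> * r)) \<and>
          measure \<mu> (cball x r) / measure \<mu> (cball x (\<eta> * r)) \<le> \<Delta>))"

definition homogeneous :: "'a::metric_space set \<Rightarrow> bool" where
  "homogeneous K \<longleftrightarrow> compact K \<and> (\<exists>\<mu>. homogeneous_measure K \<mu>)"

definition local_scale :: "'a::metric_space measure \<Rightarrow> 'a \<Rightarrow> real \<Rightarrow> real" where
  "local_scale \<mu> x r = ln (measure \<mu> (cball x r)) / ln r"

text \<open>
  Functions on \<open>(0, \<epsilon>)\<close> are represented by total functions of which only the values on \<open>(0, \<epsilon>)\<close>
  matter. The infimum and supremum are taken in the extended reals.
\<close>

definition scale_class :: "real \<Rightarrow> (real \<Rightarrow> real) set" where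
  "scale_class \<epsilon> = {g. (\<forall>r\<in>{0<..<\<epsilon>}. 0 < g r) \<and>
     0 < (INF r\<in>{0<..<\<epsilon>}. ereal (g r)) \<and> (SUP r\<in>{0<..<\<epsilon>}. ereal (g r)) < \<infinity>}"

definition scale_equiv :: "real \<Rightarrow> (real \<Rightarrow> real) \<Rightarrow> (real \<Rightarrow> real) \<Rightarrow> bool" where
  "scale_equiv \<epsilon> g h \<longleftrightarrow> (\<exists>C. \<forall>r\<in>{0<..<\<epsilon>}. \<bar>h r - g r\<bar> \<le> C * inverse \<bar>ln r\<bar>)"

text \<open>
  The functions \<open>local_scale \<mu> x\<close> depend on \<open>\<mu>\<close>; a scale function of \<open>K\<close> may come from any
  measure witnessing homogeneity.
\<close>

definition scale_function :: "'a::metric_space set \<Rightarrow> real \<Rightarrow> (real \<Rightarrow> real) \<Rightarrow> bool" where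
  "scale_function K \<epsilon> h \<longleftrightarrow>
     0 < \<epsilon> \<and> \<epsilon> < 1 \<and> \<epsilon> \<le> diameter K \<and> h \<in> scale_class \<epsilon> \<and>
     (\<exists>\<mu>. homogeneous_measure K \<mu> \<and>
        (\<forall>x\<in>K. local_scale \<mu> x \<in> scale_class \<epsilon> \<and> scale_equiv \<epsilon> (local_scale \<mu> x) h))"

end

theory Submission imports Defs begin

text \<open>
  Let \<open>m r\<close> be the measure of the ball of radius \<open>r\<close> about a fixed point of \<open>K\<close>. Since
  \<open>h r * ln r\<close> and \<open>ln (m r)\<close> differ by a bounded amount, the supremum in question is
  \<open>ln (M \<rho>) / \<bar>ln \<rho>\<bar> + O(1 / \<bar>ln \<rho>\<bar>)\<close>, where \<open>M \<rho>\<close> is the supremum of the ratios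
  \<open>m R / m (\<rho> * R)\<close>. Comparing measures of balls, covering numbers are up to constants the
  ratios \<open>m R / m r\<close>. Hence an admissible exponent \<open>\<alpha>\<close> of the Assouad dimension gives
  \<open>M \<rho> = O(\<rho> powr -\<alpha>)\<close>, so the upper limit is at most the dimension. Conversely \<open>M\<close> is
  submultiplicative, so for each single \<open>\<rho>\<close> the exponent \<open>ln (M \<rho>) / \<bar>ln \<rho>\<bar>\<close> is
  admissible and hence at least the dimension.
\<close>

section \<open>Covering numbers against ratios of ball measures\<close>

lemma finite_net_of_separated_bound:
  fixes S :: "'a::metric_space set"
  assumes "0 \<le> r"
    and bound: "\<And>C. finite C \<Longrightarrow> C \<subseteq> S \<Longrightarrow> pairwise (\<lambda>u v. r < dist u v) C \<Longrightarrow> card C \<le> N"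
  obtains C where "finite C" "C \<subseteq> S" "card C \<le> N" "S \<subseteq> (\<Union>c\<in>C. cball c r)"
proof -
  define P where "P C \<longleftrightarrow> finite C \<and> C \<subseteq> S \<and> pairwise (\<lambda>u v. r < dist u v) C" for C
  have "P {}"
    by (simp add: P_def)
  moreover have "\<forall>C. P C \<longrightarrow> card C \<le> N"
    using bound by (auto simp: P_def)
  \<comment> \<open>A separated set of largest cardinality is already a net: a point farther than
    \<open>r\<close> from all its members could be added to it.\<close>
  ultimately obtain C where C: "P C" and maxC: "\<And>C'. P C' \<Longrightarrow> card C' \<le> card C"
    using ex_has_greatest_nat[of P "{}" card "Suc N"] by (auto simp: less_Suc_eq_le)
  have "y \<in> (\<Union>c\<in>C. cball c r)" if "y \<in> S" for y
  proof (rule ccontr)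
    assume far: "y \<notin> (\<Union>c\<in>C. cball c r)"
    then have "P (insert y C)"
      using C \<open>y \<in> S\<close> by (auto simp: P_def pairwise_insert dist_commute not_le)
    moreover have "y \<notin> C"
      using far \<open>0 \<le> r\<close> by auto
    ultimately show False
      using maxC[of "insert y C"] C by (simp add: P_def)
  qed
  then show thesis
    using C bound by (intro that[of C]) (auto simp: P_def)
qed

text \<open>Isolates what homogeneity says about balls of equal radius with different centres, for
  radii up to a cutoff \<open>s\<close>. The inequality is written as a product, which suits sums
  over the centres of a cover.\<close>

locale comparable_balls =
  fixes K :: "'a::metric_space set" and \<mu> :: "'a measure" and L s :: real
  assumes compact_K: "compact K"
    and sets_borel: "sets \<mu> = sets borel"
    and null_outside: "emeasure \<mu> (- K) = 0"
    and s_pos: "0 < s"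
    and L_pos: "0 < L"
    and emeasure_pos: "\<And>x r. x \<in> K \<Longrightarrow> 0 < r \<Longrightarrow> r \<le> s \<Longrightarrow> 0 < emeasure \<mu> (cball x r)"
    and emeasure_finite: "\<And>x r. x \<in> K \<Longrightarrow> 0 < r \<Longrightarrow> r \<le> s \<Longrightarrow> emeasure \<mu> (cball x r) < \<infinity>"
    and comparable: "\<And>x y r. x \<in> K \<Longrightarrow> y \<in> K \<Longrightarrow> 0 < r \<Longrightarrow> r \<le> s \<Longrightarrow>
      measure \<mu> (cball x r) \<le> L * measure \<mu> (cball y r)"
begin

lemma cball_fmeasurable: "x \<in> K \<Longrightarrow> 0 < r \<Longrightarrow> r \<le> s \<Longrightarrow> cball x r \<in> fmeasurable \<mu>"
  using emeasure_finite[of x r] by (auto simp: fmeasurable_def sets_borel)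

lemma measure_cball_pos: "x \<in> K \<Longrightarrow> 0 < r \<Longrightarrow> r \<le> s \<Longrightarrow> 0 < measure \<mu> (cball x r)"
  using emeasure_pos[of x r] emeasure_finite[of x r]
  by (simp add: measure_def enn2real_positive_iff)

lemma measure_cball_mono:
  "x \<in> K \<Longrightarrow> 0 < r \<Longrightarrow> r \<le> R \<Longrightarrow> R \<le> s \<Longrightarrow> measure \<mu> (cball x r) \<le> measure \<mu> (cball x R)"
  by (intro measure_mono_fmeasurable cball_fmeasurable) (auto simp: sets_borel)

text \<open>Packing by volume: the balls of radius \<open>r / 2\<close> about the points of
  \<open>C\<close> are disjoint, each has at least the fraction \<open>1 / L\<close> of the measure
  of \<open>cball x (r / 2)\<close>, and all lie in \<open>cball x (2 * R)\<close> because
  \<open>R + r / 2 \<le> 2 * R\<close>.\<close>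

lemma card_separated_le:
  assumes x: "x \<in> K" and r: "0 < r" "r \<le> R" "2 * R \<le> s"
    and C: "finite C" "C \<subseteq> cball x R \<inter> K" "pairwise (\<lambda>u v. r < dist u v) C"
  shows "real (card C) * measure \<mu> (cball x (r / 2)) \<le> L * measure \<mu> (cball x (2 * R))"
proof -
  have CK: "c \<in> K" if "c \<in> C" for c
    using C(2) that by auto
  have "disjoint_family_on (\<lambda>c. cball c (r / 2)) C"
  proof -
    have "dist c d \<le> r" if "z \<in> cball c (r / 2)" "z \<in> cball d (r / 2)" for c d z
      using that dist_triangle2[of c d z] by (simp add: dist_commute)
    then show ?thesis
      using C(3) by (fastforce simp: disjoint_family_on_def pairwise_def)
  qed
  have "real (card C) * measure \<mu> (cball x (r / 2)) = (\<Sum>c\<in>C. measure \<mu> (cball x (r / 2)))"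
    by simp
  also have "\<dots> \<le> (\<Sum>c\<in>C. L * measure \<mu> (cball c (r / 2)))"
    using x r CK by (intro sum_mono comparable) auto
  also have "\<dots> = L * (\<Sum>c\<in>C. measure \<mu> (cball c (r / 2)))"
    by (simp add: sum_distrib_left)
  also have "(\<Sum>c\<in>C. measure \<mu> (cball c (r / 2))) = measure \<mu> (\<Union>c\<in>C. cball c (r / 2))"
  proof (rule measure_finite_Union[symmetric])
    show "emeasure \<mu> (cball c (r / 2)) \<noteq> \<infinity>" if "c \<in> C" for c
      using emeasure_finite[of c "r / 2"] CK[OF that] r by auto
  qed (use C \<open>disjoint_family_on _ C\<close> in \<open>auto simp: sets_borel\<close>)
  also have "\<dots> \<le> measure \<mu> (cball x (2 * R))"
  proof (rule measure_mono_fmeasurable)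
    show "(\<Union>c\<in>C. cball c (r / 2)) \<subseteq> cball x (2 * R)"
    proof clarify
      fix c z assume "c \<in> C" "z \<in> cball c (r / 2)"
      then have "dist x c \<le> R" "dist c z \<le> r / 2"
        using C(2) by auto
      then show "z \<in> cball x (2 * R)"
        using dist_triangle[of x z c] r by simp
    qed
    show "(\<Union>c\<in>C. cball c (r / 2)) \<in> sets \<mu>"
      using C(1) by (auto simp: sets_borel)
    show "cball x (2 * R) \<in> fmeasurable \<mu>"
      using x r by (intro cball_fmeasurable) auto
  qed
  finally show ?thesis
    using L_pos by simp
qed

text \<open>A maximal \<open>r\<close>-separated subset of a ball of radius \<open>R\<close> covers
  it, so the packing estimate bounds the covering number. One factor \<open>L\<close> comes from
  that estimate, the other two from moving the small and the large ball to the common centre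
  \<open>x0\<close>.\<close>

lemma cover_number_le:
  assumes x0: "x0 \<in> K" and r: "0 < r" "r \<le> R" "2 * R \<le> s"
  shows "ereal_of_enat (cover_number K r R) \<le>
    ereal (L ^ 3 * (measure \<mu> (cball x0 (2 * R)) / measure \<mu> (cball x0 (r / 2))))"
    (is "_ \<le> ereal ?B")
proof -
  have B: "0 \<le> ?B"
    using L_pos by simp
  have "\<exists>C\<subseteq>K. finite C \<and> card C \<le> nat \<lfloor>?B\<rfloor> \<and> cball x R \<inter> K \<subseteq> (\<Union>c\<in>C. cball c r \<inter> K)"
    if x: "x \<in> K" for x
  proof -
    have "card C \<le> nat \<lfloor>?B\<rfloor>"
      if C: "finite C" "C \<subseteq> cball x R \<inter> K" "pairwise (\<lambda>u v. r < dist u v) C" for C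
    proof -
      have "real (card C) * measure \<mu> (cball x0 (r / 2))
          \<le> real (card C) * (L * measure \<mu> (cball x (r / 2)))"
        using x x0 r by (intro mult_left_mono comparable) auto
      also have "\<dots> = L * (real (card C) * measure \<mu> (cball x (r / 2)))"
        by simp
      also have "\<dots> \<le> L * (L * measure \<mu> (cball x (2 * R)))"
        using card_separated_le[OF x r C] L_pos by simp
      also have "\<dots> \<le> L * (L * (L * measure \<mu> (cball x0 (2 * R))))"
        using comparable[OF x x0, of "2 * R"] r L_pos by simp
      finally have "real (card C) \<le> ?B"
        using measure_cball_pos[OF x0, of "r / 2"] r
        by (simp add: pos_le_divide_eq power3_eq_cube mult.assoc)
      then show ?thesis
        by (simp add: le_nat_floor)
    qed
    then obtain C where "finite C" "C \<subseteq> cball x R \<inter> K" "card C \<le> nat \<lfloor>?B\<rfloor>"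
      "cball x R \<inter> K \<subseteq> (\<Union>c\<in>C. cball c r)"
      using finite_net_of_separated_bound[of r "cball x R \<inter> K" "nat \<lfloor>?B\<rfloor>"] r by (metis less_imp_le)
    then show ?thesis
      by (intro exI[of _ C]) auto
  qed
  then have "cover_number K r R \<le> enat (nat \<lfloor>?B\<rfloor>)"
    unfolding cover_number_def by (intro Inf_lower) blast
  then have "ereal_of_enat (cover_number K r R) \<le> ereal_of_enat (enat (nat \<lfloor>?B\<rfloor>))"
    by (simp only: ereal_of_enat_le_iff)
  also have "\<dots> \<le> ereal ?B"
    using B of_nat_floor[of ?B] by simp
  finally show ?thesis .
qed

text \<open>Subadditivity over an optimal cover, whose balls are centred in \<open>K\<close> and
  hence comparable to \<open>cball x r\<close>. The cover only reaches
  \<open>cball x R \<inter> K\<close>, but the rest of the ball is a null set.\<close>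

lemma measure_cball_le_of_cover_number:
  assumes x: "x \<in> K" and r: "0 < r" "r \<le> s" "0 < R" "R \<le> s"
    and cov: "ereal_of_enat (cover_number K r R) \<le> ereal B"
  shows "measure \<mu> (cball x R) \<le> B * (L * measure \<mu> (cball x r))"
proof -
  let ?S = "{enat N | N. \<forall>x\<in>K. \<exists>C\<subseteq>K. finite C \<and> card C \<le> N \<and>
                        cball x R \<inter> K \<subseteq> (\<Union>c\<in>C. cball c r \<inter> K)}"
  \<comment> \<open>The infimum of the empty set in \<open>enat\<close> is infinite. A finite value
    therefore means that the set is nonempty and that its infimum is attained by an actual
    cover.\<close>
  have fin: "cover_number K r R \<noteq> \<infinity>"
    using cov by (cases "cover_number K r R") auto
  moreover have "cover_number K r R = Inf ?S"
    by (simp only: cover_number_def)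
  ultimately have "Inf ?S \<noteq> \<infinity>"
    by simp
  then have "Inf ?S \<in> ?S"
    unfolding Inf_enat_def by (metis (mono_tags, lifting) LeastI ex_in_conv)
  then have "cover_number K r R \<in> ?S"
    by (simp only: cover_number_def)
  then obtain N C where N: "cover_number K r R = enat N" and C: "C \<subseteq> K" "finite C" "card C \<le> N"
    "cball x R \<inter> K \<subseteq> (\<Union>c\<in>C. cball c r \<inter> K)"
    using x by blast
  have NB: "real N \<le> B"
    using cov N by simp
  have K: "K \<in> sets \<mu>"
    using compact_K by (simp add: sets_borel borel_compact)
  have "measure \<mu> (cball x R) = measure \<mu> (cball x R \<inter> K)"
  proof -
    have "emeasure \<mu> (cball x R - K) \<le> emeasure \<mu> (- K)"
      using K by (intro emeasure_mono) (auto simp: sets_borel)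
    then have "cball x R - K \<in> null_sets \<mu>"
      using null_outside K by (auto simp: null_sets_def sets_borel)
    then have "measure \<mu> (cball x R - (cball x R - K)) = measure \<mu> (cball x R)"
      by (intro measure_Diff_null_set) (auto simp: sets_borel)
    then show ?thesis
      by (simp add: Diff_Diff_Int)
  qed
  also have "\<dots> \<le> measure \<mu> (\<Union>c\<in>C. cball c r)"
    using C r K cball_fmeasurable by (intro measure_mono_fmeasurable fmeasurable.finite_UN) (auto simp: sets_borel)
  also have "\<dots> \<le> (\<Sum>c\<in>C. measure \<mu> (cball c r))"
    using C by (intro measure_UNION_le) (auto simp: sets_borel)
  also have "\<dots> \<le> (\<Sum>c\<in>C. L * measure \<mu> (cball x r))"
    using C x r by (intro sum_mono comparable) auto
  also have "\<dots> = real (card C) * (L * measure \<mu> (cball x r))"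
    by simp
  also have "\<dots> \<le> B * (L * measure \<mu> (cball x r))"
    using C(3) NB L_pos by (intro mult_right_mono) auto
  finally show ?thesis .
qed

section \<open>Growth of ball measures and the Assouad dimension\<close>

lemma assouad_dim_le:
  assumes x: "x \<in> K" and t: "0 \<le> t" and c: "0 < c"
    and growth: "\<And>r R. 0 < r \<Longrightarrow> r < R \<Longrightarrow> R < s \<Longrightarrow>
      measure \<mu> (cball x R) \<le> c * (R / r) powr t * measure \<mu> (cball x r)"
  shows "assouad_dim K \<le> ereal t"
proof -
  \<comment> \<open>The covering bound involves the radii \<open>2 * R\<close> and
    \<open>r / 2\<close>. Their quotient \<open>4 * (R / r)\<close> produces the factor
    \<open>4 powr t\<close>, and the growth hypothesis at \<open>2 * R\<close> forces
    \<open>R < s / 2\<close>.\<close>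
  have "ereal_of_enat (cover_number K r R) \<le> ereal (L ^ 3 * c * 4 powr t * (R / r) powr t)"
    if r: "0 < r" "r < R" "R < s / 2" for r R
  proof -
    have "measure \<mu> (cball x (2 * R)) \<le> c * (2 * R / (r / 2)) powr t * measure \<mu> (cball x (r / 2))"
      using r by (intro growth) auto
    then have "measure \<mu> (cball x (2 * R)) / measure \<mu> (cball x (r / 2)) \<le> c * (4 * (R / r)) powr t"
      using measure_cball_pos[OF x, of "r / 2"] r by (simp add: pos_divide_le_eq)
    also have "\<dots> = c * 4 powr t * (R / r) powr t"
      using r by (subst powr_mult) auto
    finally have "L ^ 3 * (measure \<mu> (cball x (2 * R)) / measure \<mu> (cball x (r / 2)))
        \<le> L ^ 3 * c * 4 powr t * (R / r) powr t"
      using L_pos by (simp add: mult.assoc del: times_divide_eq_right)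
    then show ?thesis
      using cover_number_le[OF x, of r R] r by (auto elim: order_trans)
  qed
  moreover have "0 < s / 2" "0 < L ^ 3 * c * 4 powr t"
    using s_pos L_pos c by auto
  ultimately show ?thesis
    unfolding assouad_dim_def using t by (intro Inf_lower) blast
qed

text \<open>Submultiplicativity at work: the estimate for one \<rho> is iterated along the radii
  \<open>\<rho> ^ n * R\<close> until they drop to \<open>r\<close>. Rounding the number of steps up
  costs at most one extra step, which is the factor
  \<open>exp (t * \<bar>ln \<rho>\<bar>)\<close>.\<close>

lemma growth_of_single_ratio:
  assumes x: "x \<in> K" and \<rho>: "0 < \<rho>" "\<rho> < 1"
    and ratio: "\<And>R. 0 < R \<Longrightarrow> R < s \<Longrightarrow>
      ln (measure \<mu> (cball x R)) - ln (measure \<mu> (cball x (\<rho> * R))) \<le> t * \<bar>ln \<rho>\<bar>"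
    and r: "0 < r" "r < R" "R < s"
  shows "measure \<mu> (cball x R) \<le> exp (t * \<bar>ln \<rho>\<bar>) * (R / r) powr t * measure \<mu> (cball x r)"
proof -
  define g where "g r = ln (measure \<mu> (cball x r))" for r
  have g_mono: "g u \<le> g v" if "0 < u" "u \<le> v" "v \<le> s" for u v
    using measure_cball_pos[OF x, of u] measure_cball_pos[OF x, of v] measure_cball_mono[OF x, of u v] that
    by (simp add: g_def)
  have lnr: "0 < \<bar>ln \<rho>\<bar>"
    using \<rho> by simp
  \<comment> \<open>The sign of \<open>t\<close> is forced: the left side of \<open>ratio\<close> is
    nonnegative because ball measures increase with the radius.\<close>
  have "0 \<le> t * \<bar>ln \<rho>\<bar>"
    using ratio[of "s / 2"] g_mono[of "\<rho> * (s / 2)" "s / 2"] \<rho> s_pos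
    unfolding g_def[symmetric] by (simp add: mult_le_cancel_right1)
  then have t: "0 \<le> t"
    using lnr by (simp add: zero_le_mult_iff)
  have iter: "g R - g (\<rho> ^ n * R) \<le> real n * (t * \<bar>ln \<rho>\<bar>)" for n
  proof (induction n)
    case (Suc n)
    have "\<rho> ^ n * R \<le> R"
      using \<rho> r by (simp add: mult_le_cancel_right1 power_le_one)
    then have "g (\<rho> ^ n * R) - g (\<rho> * (\<rho> ^ n * R)) \<le> t * \<bar>ln \<rho>\<bar>"
      using ratio[of "\<rho> ^ n * R"] \<rho> r le_less_trans[OF _ r(3)] by (simp add: g_def)
    then show ?case
      using Suc by (simp add: distrib_right mult.assoc)
  qed simp
  \<comment> \<open>The least number of steps with \<open>\<rho> ^ n * R \<le> r\<close>.\<close>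
  define n where "n = nat \<lceil>ln (R / r) / \<bar>ln \<rho>\<bar>\<rceil>"
  have q: "0 \<le> ln (R / r) / \<bar>ln \<rho>\<bar>"
    using r by simp
  have n: "ln (R / r) / \<bar>ln \<rho>\<bar> \<le> real n" "real n \<le> ln (R / r) / \<bar>ln \<rho>\<bar> + 1"
    unfolding n_def using q by linarith+
  have "ln (R / r) \<le> real n * \<bar>ln \<rho>\<bar>"
    using n(1) lnr by (simp only: pos_divide_le_eq)
  then have "ln (\<rho> ^ n * R) \<le> ln r"
    using \<rho> r by (simp add: ln_mult ln_realpow ln_div)
  then have "\<rho> ^ n * R \<le> r"
    using \<rho> r by simp
  then have "g R - g r \<le> real n * (t * \<bar>ln \<rho>\<bar>)"
    using iter[of n] g_mono[of "\<rho> ^ n * R" r] \<rho> r by simp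
  also have "\<dots> \<le> (ln (R / r) / \<bar>ln \<rho>\<bar> + 1) * (t * \<bar>ln \<rho>\<bar>)"
    using n(2) t by (intro mult_right_mono) auto
  also have "\<dots> = t * \<bar>ln \<rho>\<bar> + t * ln (R / r)"
    using lnr by (simp add: field_simps)
  finally have "exp (g R) \<le> exp (t * \<bar>ln \<rho>\<bar> + t * ln (R / r) + g r)"
    by simp
  then show ?thesis
    using r measure_cball_pos[OF x, of R] measure_cball_pos[OF x, of r]
    by (simp add: g_def exp_add powr_def)
qed

text \<open>Serves twice: with an arbitrary \<rho> to bound the dimension by the supremum in the
  theorem, and with the doubling ratio \<eta> to show that the dimension is finite.\<close>

lemma assouad_dim_le_single_ratio:
  assumes "x \<in> K" "0 < \<rho>" "\<rho> < 1" "0 \<le> t"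
    and "\<And>R. 0 < R \<Longrightarrow> R < s \<Longrightarrow>
      ln (measure \<mu> (cball x R)) - ln (measure \<mu> (cball x (\<rho> * R))) \<le> t * \<bar>ln \<rho>\<bar>"
  shows "assouad_dim K \<le> ereal t"
  using assms by (intro assouad_dim_le[where c = "exp (t * \<bar>ln \<rho>\<bar>)"] growth_of_single_ratio) auto

text \<open>The point is that \<open>D\<close> depends on neither \<rho> nor \<open>R\<close>, so it
  disappears after division by \<open>\<bar>ln \<rho>\<bar>\<close>. Radii below \<open>b\<close>
  are treated by the cover estimate; the remaining ones, up to \<open>s\<close>, only enlarge
  \<open>D\<close>.\<close>

lemma ratio_le_of_cover_exponent:
  assumes x: "x \<in> K" and b: "0 < b" and c: "0 < c"
    and cov: "\<And>r R. 0 < r \<Longrightarrow> r < R \<Longrightarrow> R < b \<Longrightarrow>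
      ereal_of_enat (cover_number K r R) \<le> ereal (c * (R / r) powr \<alpha>)"
  obtains D where "\<And>\<rho> R. 0 < \<rho> \<Longrightarrow> \<rho> < 1 \<Longrightarrow> 0 < R \<Longrightarrow> R < s \<Longrightarrow>
    ln (measure \<mu> (cball x R)) - ln (measure \<mu> (cball x (\<rho> * R))) \<le> \<alpha> * \<bar>ln \<rho>\<bar> + D"
proof -
  define g where "g r = ln (measure \<mu> (cball x r))" for r
  have g_mono: "g u \<le> g v" if "0 < u" "u \<le> v" "v \<le> s" for u v
    using measure_cball_pos[OF x, of u] measure_cball_pos[OF x, of v] measure_cball_mono[OF x, of u v] that
    by (simp add: g_def)
  have small: "g R - g (\<rho> * R) \<le> \<alpha> * \<bar>ln \<rho>\<bar> + ln (c * L)"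
    if \<rho>: "0 < \<rho>" "\<rho> < 1" and R: "0 < R" "R < b" "R \<le> s" for \<rho> R
  proof -
    have le: "\<rho> * R < R"
      using \<rho> R by simp
    have pos: "0 < measure \<mu> (cball x R)" "0 < measure \<mu> (cball x (\<rho> * R))"
      using x \<rho> R less_le_trans[OF le R(3)] by (auto intro!: measure_cball_pos)
    have "measure \<mu> (cball x R) \<le> c * (R / (\<rho> * R)) powr \<alpha> * (L * measure \<mu> (cball x (\<rho> * R)))"
      using \<rho> R le less_le_trans[OF le R(3)]
      by (intro measure_cball_le_of_cover_number cov x) auto
    also have "R / (\<rho> * R) = inverse \<rho>"
      using R by (simp add: field_simps)
    finally have "g R \<le> ln (c * (inverse \<rho>) powr \<alpha> * (L * measure \<mu> (cball x (\<rho> * R))))"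
      unfolding g_def using pos c L_pos \<rho> by (subst ln_le_cancel_iff) auto
    also have "\<dots> = ln c + \<alpha> * ln (inverse \<rho>) + (ln L + g (\<rho> * R))"
      unfolding g_def using pos c L_pos \<rho> by (simp add: ln_mult ln_powr)
    finally show ?thesis
      using \<rho> c L_pos by (simp add: ln_inverse ln_mult)
  qed
  \<comment> \<open>A reference radius strictly below \<open>b\<close>. For
    \<open>R \<ge> a\<close>, monotonicity gives \<open>g R \<le> g s\<close> and
    \<open>g (\<rho> * a) \<le> g (\<rho> * R)\<close>, so passing from \<open>R\<close> to
    \<open>a\<close> costs at most \<open>g s - g a\<close>.\<close>
  define a where "a = min (b / 2) s"
  have a: "0 < a" "a < b" "a \<le> s"
    using b s_pos by (auto simp: a_def)
  have "g R - g (\<rho> * R) \<le> \<alpha> * \<bar>ln \<rho>\<bar> + (ln (c * L) + (g s - g a))"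
    if \<rho>: "0 < \<rho>" "\<rho> < 1" and R: "0 < R" "R < s" for \<rho> R
  proof (cases "R < a")
    case True
    then show ?thesis
      using small[OF \<rho> R(1)] a R g_mono[of a s] by simp
  next
    case False
    then have "g (\<rho> * a) \<le> g (\<rho> * R)"
      using \<rho> a R by (intro g_mono) (auto simp: mult_le_one intro: order_trans[OF mult_right_mono, of \<rho> 1])
    moreover have "g R \<le> g s"
      using R by (intro g_mono) auto
    ultimately show ?thesis
      using small[OF \<rho> a] by simp
  qed
  then show thesis
    by (intro that) (simp add: g_def)
qed

end

section \<open>Comparability and doubling from homogeneity\<close>

lemma homogeneous_measure_comparable_balls:
  assumes "homogeneous_measure K \<mu>" "compact K" "0 < s" "s \<le> diameter K"
  obtains L where "comparable_balls K \<mu> L s"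
proof -
  obtain L where L: "1 \<le> L" and *: "\<And>x y r. x \<in> K \<Longrightarrow> y \<in> K \<Longrightarrow> 0 < r \<Longrightarrow> r \<le> diameter K \<Longrightarrow>
      measure \<mu> (cball x r) / measure \<mu> (cball y r) \<le> L"
    using assms(1) unfolding homogeneous_measure_def by blast
  have pos: "0 < measure \<mu> (cball y r)" if "y \<in> K" "0 < r" "r \<le> diameter K" for y r
    using assms(1) that by (simp add: homogeneous_measure_def measure_def enn2real_positive_iff)
  have "measure \<mu> (cball x r) \<le> L * measure \<mu> (cball y r)"
    if "x \<in> K" "y \<in> K" "0 < r" "r \<le> s" for x y r
    using *[of x y r] pos[of y r] that assms(4) by (simp add: pos_divide_le_eq)
  then have "comparable_balls K \<mu> L s"
    using assms L by unfold_locales (auto simp: homogeneous_measure_def)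
  then show thesis
    by (rule that)
qed

text \<open>Puts the bound \<Delta> in the form of a single-ratio estimate with exponent
  \<open>ln \<Delta> / \<bar>ln \<eta>\<bar>\<close>, ready to bound the dimension by a real
  number.\<close>

lemma homogeneous_measure_doubling:
  assumes "homogeneous_measure K \<mu>" "x \<in> K"
  obtains \<eta> t where "0 < \<eta>" "\<eta> < 1" "0 \<le> t"
    "\<And>R. 0 < R \<Longrightarrow> R \<le> diameter K \<Longrightarrow>
      ln (measure \<mu> (cball x R)) - ln (measure \<mu> (cball x (\<eta> * R))) \<le> t * \<bar>ln \<eta>\<bar>"
proof -
  obtain \<eta> \<delta> \<Delta> where \<eta>: "0 < \<eta>" "\<eta> < 1" "1 < \<delta>" "\<delta> \<le> \<Delta>"
    and *: "\<And>R. 0 < R \<Longrightarrow> R \<le> diameter K \<Longrightarrow>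
      measure \<mu> (cball x R) / measure \<mu> (cball x (\<eta> * R)) \<le> \<Delta>"
    using assms unfolding homogeneous_measure_def by blast
  have pos: "0 < measure \<mu> (cball x r)" if "0 < r" "r \<le> diameter K" for r
    using assms that by (simp add: homogeneous_measure_def measure_def enn2real_positive_iff)
  have "ln (measure \<mu> (cball x R)) - ln (measure \<mu> (cball x (\<eta> * R))) \<le> ln \<Delta> / \<bar>ln \<eta>\<bar> * \<bar>ln \<eta>\<bar>"
    if R: "0 < R" "R \<le> diameter K" for R
  proof -
    have "\<eta> * R \<le> R"
      using \<eta> R by simp
    then have "\<eta> * R \<le> diameter K"
      using R by linarith
    then have "0 < measure \<mu> (cball x R)" "0 < measure \<mu> (cball x (\<eta> * R))"
      using \<eta> R by (auto intro!: pos)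
    moreover from this have "ln (measure \<mu> (cball x R) / measure \<mu> (cball x (\<eta> * R))) \<le> ln \<Delta>"
      using *[OF R] by (intro ln_mono) auto
    ultimately have "ln (measure \<mu> (cball x R)) - ln (measure \<mu> (cball x (\<eta> * R))) \<le> ln \<Delta>"
      by (simp add: ln_div)
    then show ?thesis
      using \<eta> by simp
  qed
  moreover have "0 \<le> ln \<Delta> / \<bar>ln \<eta>\<bar>"
    using \<eta> by (intro divide_nonneg_nonneg) auto
  ultimately show thesis
    using \<eta> by (intro that[of \<eta> "ln \<Delta> / \<bar>ln \<eta>\<bar>"])
qed

section \<open>The limit formula\<close>

theorem theorem3:
  fixes K :: "'a::metric_space set" and h :: "real \<Rightarrow> real" and \<epsilon> :: real
  assumes "homogeneous K"
    and "scale_function K \<epsilon> h"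
  shows "((\<lambda>\<rho>. SUP R\<in>{0<..<\<epsilon>}.
             ereal \<bar>(h R * ln R - h (\<rho> * R) * ln (\<rho> * R)) / ln \<rho>\<bar>)
           \<longlongrightarrow> assouad_dim K) (at_right 0)"
proof -
  have \<epsilon>: "0 < \<epsilon>" "\<epsilon> < 1" "\<epsilon> \<le> diameter K"
    using assms(2) by (auto simp: scale_function_def)
  obtain \<mu> where \<mu>: "homogeneous_measure K \<mu>"
    and equiv: "\<And>x. x \<in> K \<Longrightarrow> scale_equiv \<epsilon> (local_scale \<mu> x) h"
    using assms(2) by (auto simp: scale_function_def)
  \<comment> \<open>The empty set has diameter 0, whereas
    \<open>0 < \<epsilon> \<le> diameter K\<close>.\<close>
  have "K \<noteq> {}"
    using \<epsilon> by auto
  then obtain x where x: "x \<in> K"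
    by blast
  obtain L where "comparable_balls K \<mu> L \<epsilon>"
    using homogeneous_measure_comparable_balls[OF \<mu> _ \<epsilon>(1,3)] assms(1)
    by (auto simp: homogeneous_def)
  then interpret comparable_balls K \<mu> L \<epsilon> .
  define g where "g r = ln (measure \<mu> (cball x r))" for r
  define f where "f r = h r * ln r" for r
  define S where "S \<rho> = (SUP R\<in>{0<..<\<epsilon>}. ereal \<bar>(f R - f (\<rho> * R)) / ln \<rho>\<bar>)" for \<rho>
  have in_range: "\<rho> * R \<in> {0<..<\<epsilon>}" "\<rho> * R \<le> R"
    if "0 < \<rho>" "\<rho> < 1" "R \<in> {0<..<\<epsilon>}" for \<rho> R
    using that mult_strict_right_mono[of \<rho> 1 R] less_trans[of "\<rho> * R" R \<epsilon>] by auto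

  obtain C where C: "\<And>r. r \<in> {0<..<\<epsilon>} \<Longrightarrow> \<bar>h r - local_scale \<mu> x r\<bar> \<le> C * inverse \<bar>ln r\<bar>"
    using equiv[OF x] unfolding scale_equiv_def by blast
  \<comment> \<open>Multiplication by \<open>ln r\<close>, nonzero since
    \<open>\<epsilon> < 1\<close>, turns the equivalence error \<open>C / \<bar>ln r\<bar>\<close>
    into a constant.\<close>
  have fg: "\<bar>f r - g r\<bar> \<le> C" if "r \<in> {0<..<\<epsilon>}" for r
  proof -
    have ln: "ln r < 0"
      using that \<epsilon> by simp
    have "f r - g r = (h r - local_scale \<mu> x r) * ln r"
      using ln by (simp add: f_def g_def local_scale_def field_simps)
    then have "\<bar>f r - g r\<bar> = \<bar>h r - local_scale \<mu> x r\<bar> * \<bar>ln r\<bar>"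
      by (simp add: abs_mult)
    also have "\<dots> \<le> C * inverse \<bar>ln r\<bar> * \<bar>ln r\<bar>"
      using C[OF that] by (intro mult_right_mono) auto
    also have "\<dots> = C"
      using ln by simp
    finally show ?thesis .
  qed
  have "0 \<le> C"
    using fg[of "\<epsilon> / 2"] \<epsilon> by simp

  \<comment> \<open>The term \<open>2 * C\<close> pays for replacing \<open>f\<close> by
    \<open>g\<close> at both \<open>R\<close> and \<open>\<rho> * R\<close>. An infinite supremum
    makes the claim trivial, and the value minus infinity is excluded by a nonnegative member of the
    family.\<close>
  have dim_le: "assouad_dim K \<le> S \<rho> + ereal (2 * C / \<bar>ln \<rho>\<bar>)" if \<rho>: "0 < \<rho>" "\<rho> < 1" for \<rho>
  proof (cases "S \<rho>")
    case (real u)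
    have Su: "\<bar>(f R - f (\<rho> * R)) / ln \<rho>\<bar> \<le> u" if "R \<in> {0<..<\<epsilon>}" for R
    proof -
      have "ereal \<bar>(f R - f (\<rho> * R)) / ln \<rho>\<bar> \<le> S \<rho>"
        unfolding S_def using that by (rule SUP_upper)
      then show ?thesis
        using real by simp
    qed
    have ln: "0 < \<bar>ln \<rho>\<bar>"
      using \<rho> by simp
    have "0 \<le> u"
      using order_trans[OF abs_ge_zero Su[of "\<epsilon> / 2"]] \<epsilon> by simp
    have "g R - g (\<rho> * R) \<le> (u + 2 * C / \<bar>ln \<rho>\<bar>) * \<bar>ln \<rho>\<bar>" if "0 < R" "R < \<epsilon>" for R
    proof -
      have R: "R \<in> {0<..<\<epsilon>}"
        using that by simp
      have "\<bar>f R - f (\<rho> * R)\<bar> \<le> u * \<bar>ln \<rho>\<bar>"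
        using Su[OF R] ln by (simp add: abs_divide pos_divide_le_eq)
      then have "g R - g (\<rho> * R) \<le> u * \<bar>ln \<rho>\<bar> + 2 * C"
        using fg[OF R] fg[OF in_range(1)[OF \<rho> R]] by linarith
      also have "\<dots> = (u + 2 * C / \<bar>ln \<rho>\<bar>) * \<bar>ln \<rho>\<bar>"
        using ln by (simp add: distrib_right)
      finally show ?thesis .
    qed
    moreover have "0 \<le> u + 2 * C / \<bar>ln \<rho>\<bar>"
      using \<open>0 \<le> u\<close> \<open>0 \<le> C\<close> by (intro add_nonneg_nonneg divide_nonneg_nonneg) auto
    ultimately have "assouad_dim K \<le> ereal (u + 2 * C / \<bar>ln \<rho>\<bar>)"
      using \<rho> x unfolding g_def by (intro assouad_dim_le_single_ratio)
    then show ?thesis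
      using real by simp
  next
    case MInf
    have "ereal \<bar>(f (\<epsilon> / 2) - f (\<rho> * (\<epsilon> / 2))) / ln \<rho>\<bar> \<le> S \<rho>"
      unfolding S_def using \<epsilon> by (intro SUP_upper) auto
    then show ?thesis
      using MInf by simp
  qed simp

  have le_exponent: "\<exists>D. \<forall>\<rho>. 0 < \<rho> \<and> \<rho> < 1 \<longrightarrow> S \<rho> \<le> ereal (\<alpha> + D / \<bar>ln \<rho>\<bar>)"
    if b: "0 < b" "0 < c"
      and cov: "\<forall>r R. 0 < r \<and> r < R \<and> R < b \<longrightarrow>
        ereal_of_enat (cover_number K r R) \<le> ereal (c * (R / r) powr \<alpha>)" for \<alpha> b c
  proof -
    obtain D where D: "\<And>\<rho> R. 0 < \<rho> \<Longrightarrow> \<rho> < 1 \<Longrightarrow> 0 < R \<Longrightarrow> R < \<epsilon> \<Longrightarrow>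
        g R - g (\<rho> * R) \<le> \<alpha> * \<bar>ln \<rho>\<bar> + D"
      using ratio_le_of_cover_exponent[OF x b, of \<alpha>] cov unfolding g_def by blast
    have "S \<rho> \<le> ereal (\<alpha> + (D + 2 * C) / \<bar>ln \<rho>\<bar>)" if \<rho>: "0 < \<rho>" "\<rho> < 1" for \<rho>
      unfolding S_def
    proof (rule SUP_least)
      fix R assume R: "R \<in> {0<..<\<epsilon>}"
      have ln: "0 < \<bar>ln \<rho>\<bar>"
        using \<rho> by simp
      \<comment> \<open>Needed for the absolute value: it gives
        \<open>f R - f (\<rho> * R) \<ge> - 2 * C\<close> and shows that
        \<open>\<alpha> * \<bar>ln \<rho>\<bar> + D\<close> is nonnegative.\<close>
      have "g (\<rho> * R) \<le> g R"
        using measure_cball_pos[OF x, of R] measure_cball_pos[OF x, of "\<rho> * R"] in_range[OF \<rho> R]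
          measure_cball_mono[OF x, of "\<rho> * R" R] R by (simp add: g_def)
      then have "\<bar>f R - f (\<rho> * R)\<bar> \<le> \<alpha> * \<bar>ln \<rho>\<bar> + D + 2 * C"
        using D[OF \<rho>, of R] R fg[OF R] fg[OF in_range(1)[OF \<rho> R]] by simp
      then show "ereal \<bar>(f R - f (\<rho> * R)) / ln \<rho>\<bar> \<le> ereal (\<alpha> + (D + 2 * C) / \<bar>ln \<rho>\<bar>)"
        using ln by (simp add: abs_divide field_simps)
    qed
    then show ?thesis
      by blast
  qed

  have lim0: "((\<lambda>\<rho>. ereal (a + D / \<bar>ln \<rho>\<bar>)) \<longlongrightarrow> ereal a) (at_right 0)" for a D :: real
  proof -
    have "filterlim (\<lambda>\<rho>::real. ln \<rho>) at_infinity (at_right 0)"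
      using ln_at_0 at_bot_le_at_infinity by (rule filterlim_mono) simp
    then have "filterlim (\<lambda>\<rho>::real. \<bar>ln \<rho>\<bar>) at_top (at_right 0)"
      using filterlim_at_infinity_imp_norm_at_top by fastforce
    then have "((\<lambda>\<rho>::real. D / \<bar>ln \<rho>\<bar>) \<longlongrightarrow> 0) (at_right 0)"
      by (rule real_tendsto_divide_at_top[OF tendsto_const])
    from tendsto_add[OF tendsto_const this, of a] show ?thesis
      by simp
  qed
  have near0: "\<forall>\<^sub>F \<rho> in at_right 0. 0 < \<rho> \<and> \<rho> < (1::real)"
    using eventually_at_right_real[of 0 1] by simp

  \<comment> \<open>With a real value of the dimension, \<open>lim0\<close> applies to it and the
    error term in \<open>dim_le\<close> can be moved to the other side.\<close>
  obtain d where d: "assouad_dim K = ereal d"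
  proof (rule homogeneous_measure_doubling[OF \<mu> x])
    fix \<eta> t
    assume "0 < \<eta>" "\<eta> < 1" "0 \<le> t" and "\<And>R. 0 < R \<Longrightarrow> R \<le> diameter K \<Longrightarrow>
        ln (measure \<mu> (cball x R)) - ln (measure \<mu> (cball x (\<eta> * R))) \<le> t * \<bar>ln \<eta>\<bar>"
    then have "assouad_dim K \<le> ereal t"
      using x \<epsilon> by (intro assouad_dim_le_single_ratio[of x \<eta>]) auto
    moreover have "0 \<le> assouad_dim K"
      unfolding assouad_dim_def by (rule Inf_greatest) auto
    ultimately show thesis
      using that by (cases "assouad_dim K") auto
  qed

  have "(S \<longlongrightarrow> assouad_dim K) (at_right 0)"
  proof (rule order_tendstoI)
    fix a assume "a < assouad_dim K"
    then have "\<forall>\<^sub>F \<rho> in at_right 0. a < ereal (d + (- 2 * C) / \<bar>ln \<rho>\<bar>)"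
      using d by (intro order_tendstoD(1)[OF lim0]) simp
    then show "\<forall>\<^sub>F \<rho> in at_right 0. a < S \<rho>"
      using near0
    proof eventually_elim
      case (elim \<rho>)
      have "ereal (d + (- 2 * C) / \<bar>ln \<rho>\<bar>) \<le> S \<rho>"
        using dim_le[of \<rho>] elim d by (cases "S \<rho>") auto
      then show ?case
        using elim by simp
    qed
  next
    fix a assume "assouad_dim K < a"
    \<comment> \<open>An infimum below \<open>a\<close> has an admissible exponent below
      \<open>a\<close>; its error \<open>D / \<bar>ln \<rho>\<bar>\<close> vanishes in the
      limit.\<close>
    then obtain \<alpha> b c where \<alpha>: "ereal \<alpha> < a" and cov: "0 < b" "0 < c"
      "\<forall>r R. 0 < r \<and> r < R \<and> R < b \<longrightarrow>
        ereal_of_enat (cover_number K r R) \<le> ereal (c * (R / r) powr \<alpha>)"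
      unfolding assouad_dim_def Inf_less_iff by blast
    obtain D where D: "\<And>\<rho>. 0 < \<rho> \<Longrightarrow> \<rho> < 1 \<Longrightarrow> S \<rho> \<le> ereal (\<alpha> + D / \<bar>ln \<rho>\<bar>)"
      using le_exponent[OF cov] by blast
    have "\<forall>\<^sub>F \<rho> in at_right 0. ereal (\<alpha> + D / \<bar>ln \<rho>\<bar>) < a"
      using \<alpha> by (rule order_tendstoD(2)[OF lim0])
    then show "\<forall>\<^sub>F \<rho> in at_right 0. S \<rho> < a"
      using near0
    proof eventually_elim
      case (elim \<rho>)
      then show ?case
        using le_less_trans[OF D] by blast
    qed
  qed
  then show ?thesis
    unfolding S_def f_def .
qed

end
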